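(* Let $B$ be a locale. An open $B$-locale $X$ is étale if and only if its projection $p:X\to B$ is a local homeomorphism.
   Context: A locale is a frame; a homomorphism of locales preserves arbitrary joins and finite meets; a map of locales $f:X\to Y$ is a homomorphism $f^*:Y\to X$. A $B$-module is a complete lattice $X$ with an action $B\times X\to X$, $(b,x)\mapsto bx$, preserving arbitrary joins in each variable and satisfying $1x=x$ and $(b\wedge c)x=b(cx)$. A homomorphism of $B$-modules preserves arbitrary joins and the action. A $B$-locale is a locale $X$ equipped with a $B$-module structure such that $bx=b1\wedge x$ for all $b\in B$, $x\in X$. Its projection is the map of locales $p:X\to B$ defined by $p^*(b)=b1$. A $B$-locale $X$ is open if $p^*:B\to X$ has a left adjoint $p_!:X\to B$ which is a homomorphism of $B$-modules; in that case one writes $\varsigma=p_!$ and calls it the support of $X$. A local section of an open $B$-locale $X$ is an element $s\in X$ such that $\varsigma(x)s=x$ for all $x\le s$. The set of local sections is denoted $\mathit{\Gamma}_X$. An open $B$-locale $X$ is étale if $\bigvee\mathit{\Gamma}_X=1$. The projection $p$ of an open $B$-locale is a local homeomorphism if there is a set $\mathit{\Gamma}\subset X$ with $\bigvee\mathit{\Gamma}=1$ such that on each open sublocale determined by an element of $\mathit{\Gamma}$ the map $p$ restricts to a homeomorphism onto its image; that is, for each $s\in\mathit{\Gamma}$ there is an isomorphism of locales $\theta_s:{\downarrow}\varsigma(s)\to{\downarrow}s$ such that $\theta_s(b\wedge\varsigma(s))=p^*(b)\wedge s$ for all $b\in B$, where ${\downarrow}y=\{z\mid z\le y\}$. *)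

theory Defs
  imports Main
begin

unbundle lattice_syntax

text \<open>
  The library class \<open>complete_distrib_lattice\<close> demands complete distributivity and is thus
  strictly stronger than the frame law.
\<close>

class frame = complete_lattice +
  assumes inf_Sup_frame: "x \<sqinter> \<Squnion>S = (\<Squnion>y\<in>S. x \<sqinter> y)"

text \<open>
  The order ideal \<open>{..a}\<close> of a frame is again a frame: its joins (the empty one included) and
  binary meets are those of the ambient frame, and its top is \<open>a\<close>.  A homomorphism between two
  such frames is a function that only matters on \<open>{..a}\<close>.  Whole frames are the case
  \<open>a = \<top>\<close>, \<open>b = \<top>\<close>.
\<close>

definition frame_hom_down :: "'a::frame \<Rightarrow> 'c::frame \<Rightarrow> ('a \<Rightarrow> 'c) \<Rightarrow> bool" where
  "frame_hom_down a b f \<longleftrightarrow>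
     f ` {..a} \<subseteq> {..b} \<and>
     (\<forall>S. S \<subseteq> {..a} \<longrightarrow> f (\<Squnion>S) = \<Squnion>(f ` S)) \<and>
     f a = b \<and>
     (\<forall>x\<in>{..a}. \<forall>y\<in>{..a}. f (x \<sqinter> y) = f x \<sqinter> f y)"

abbreviation frame_hom :: "('a::frame \<Rightarrow> 'c::frame) \<Rightarrow> bool" where
  "frame_hom f \<equiv> frame_hom_down \<top> \<top> f"

text \<open>
  An isomorphism of locales is an invertible frame homomorphism; the direction of the
  underlying function is immaterial since its inverse is again one.
\<close>

definition locale_iso_down :: "'a::frame \<Rightarrow> 'c::frame \<Rightarrow> ('a \<Rightarrow> 'c) \<Rightarrow> bool" where
  "locale_iso_down a b f \<longleftrightarrow>
     frame_hom_down a b f \<and>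
     (\<exists>g. frame_hom_down b a g \<and> (\<forall>x\<in>{..a}. g (f x) = x) \<and> (\<forall>y\<in>{..b}. f (g y) = y))"

locale B_module =
  fixes act :: "'b::frame \<Rightarrow> 'x::complete_lattice \<Rightarrow> 'x"
  assumes act_Sup_left: "act (\<Squnion>S) x = (\<Squnion>b\<in>S. act b x)"
    and act_Sup_right: "act b (\<Squnion>T) = (\<Squnion>x\<in>T. act b x)"
    and act_top: "act \<top> x = x"
    and act_inf: "act (b \<sqinter> c) x = act b (act c x)"

text \<open>The frame \<open>B\<close> is regarded as a module over itself by means of binary meet.\<close>

lemma B_module_inf: "B_module (inf :: 'b::frame \<Rightarrow> 'b \<Rightarrow> 'b)"
proof
  show "\<Squnion>S \<sqinter> x = (\<Squnion>b\<in>S. b \<sqinter> x)" for S and x :: 'b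
    using inf_Sup_frame[of x S] by (simp add: inf.commute)
qed (auto simp: inf_Sup_frame inf.assoc)

locale B_module_hom = dom: B_module act + cod: B_module act'
  for act :: "'b::frame \<Rightarrow> 'x::complete_lattice \<Rightarrow> 'x"
    and act' :: "'b \<Rightarrow> 'y::complete_lattice \<Rightarrow> 'y"
    and h :: "'x \<Rightarrow> 'y" +
  assumes hom_Sup: "h (\<Squnion>S) = \<Squnion>(h ` S)"
    and hom_act: "h (act b x) = act' b (h x)"

locale B_locale = B_module act
  for act :: "'b::frame \<Rightarrow> 'x::frame \<Rightarrow> 'x" +
  assumes act_eq: "act b x = act b \<top> \<sqinter> x"

text \<open>The map of locales \<open>p : X \<rightarrow> B\<close> is given by its inverse image homomorphism \<open>p\<^sup>* : B \<rightarrow> X\<close>.\<close>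

definition proj_inv :: "('b::frame \<Rightarrow> 'x::frame \<Rightarrow> 'x) \<Rightarrow> 'b \<Rightarrow> 'x" where
  "proj_inv act b = act b \<top>"

lemma (in B_locale) frame_hom_proj_inv: "frame_hom (proj_inv act)"
proof -
  have "act (b \<sqinter> c) \<top> = act b \<top> \<sqinter> act c \<top>" for b c
    using act_inf[of b c \<top>] act_eq[of b "act c \<top>"] by simp
  then show ?thesis
    by (auto simp: frame_hom_down_def proj_inv_def act_Sup_left act_top)
qed

definition left_adjoint :: "('x::order \<Rightarrow> 'b::order) \<Rightarrow> ('b \<Rightarrow> 'x) \<Rightarrow> bool" where
  "left_adjoint f g \<longleftrightarrow> (\<forall>x b. f x \<le> b \<longleftrightarrow> x \<le> g b)"

lemma left_adjoint_unique: "left_adjoint f g \<Longrightarrow> left_adjoint f' g \<Longrightarrow> f = f'"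
  unfolding left_adjoint_def by (metis ext order.antisym order.refl)

locale open_B_locale = B_locale act
  for act :: "'b::frame \<Rightarrow> 'x::frame \<Rightarrow> 'x" +
  assumes ex_direct_image: "\<exists>f. left_adjoint f (proj_inv act) \<and> B_module_hom act inf f"

definition support :: "('b::frame \<Rightarrow> 'x::frame \<Rightarrow> 'x) \<Rightarrow> 'x \<Rightarrow> 'b" where
  "support act = (THE f. left_adjoint f (proj_inv act))"

lemma (in open_B_locale) support_left_adjoint: "left_adjoint (support act) (proj_inv act)"
  and support_hom: "B_module_hom act inf (support act)"
proof -
  obtain f where f: "left_adjoint f (proj_inv act)" "B_module_hom act inf f"
    using ex_direct_image by blast
  then have "support act = f"
    unfolding support_def by (blast intro: left_adjoint_unique)
  with f show "left_adjoint (support act) (proj_inv act)" "B_module_hom act inf (support act)"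
    by simp_all
qed

definition local_sections :: "('b::frame \<Rightarrow> 'x::frame \<Rightarrow> 'x) \<Rightarrow> 'x set" where
  "local_sections act = {s. \<forall>x\<le>s. act (support act x) s = x}"

definition etale :: "('b::frame \<Rightarrow> 'x::frame \<Rightarrow> 'x) \<Rightarrow> bool" where
  "etale act \<longleftrightarrow> open_B_locale act \<and> \<Squnion>(local_sections act) = \<top>"

definition proj_local_homeomorphism :: "('b::frame \<Rightarrow> 'x::frame \<Rightarrow> 'x) \<Rightarrow> bool" where
  "proj_local_homeomorphism act \<longleftrightarrow>
     open_B_locale act \<and>
     (\<exists>G. \<Squnion>G = \<top> \<and>
       (\<forall>s\<in>G. \<exists>\<theta>. locale_iso_down (support act s) s \<theta> \<and>
         (\<forall>b. \<theta> (b \<sqinter> support act s) = proj_inv act b \<sqinter> s)))"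

end

theory Submission
  imports Defs
begin

text \<open>
  An element \<open>s\<close> is a local section if and only if \<open>p\<close> restricts to a homeomorphism from the open
  sublocale of \<open>s\<close> onto its image.  The only candidate for the isomorphism is \<open>b \<mapsto> b s\<close>, and
  its inverse is the support: \<open>\<varsigma>(b s) = b \<sqinter> \<varsigma>(s) = b\<close> holds for \<open>b \<le> \<varsigma>(s)\<close> in any open
  \<open>B\<close>-locale, while \<open>\<varsigma>(x) s = x\<close> for \<open>x \<le> s\<close> is the definition of a local section.
\<close>

context B_locale
begin

lemma act_eq_proj_inv: "act b x = proj_inv act b \<sqinter> x"
  unfolding proj_inv_def by (rule act_eq)

lemma act_le: "act b x \<le> x"
  by (simp add: act_eq_proj_inv)

lemma act_inf_left: "act (b \<sqinter> c) x = act b x \<sqinter> act c x"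
proof -
  have "act (b \<sqinter> c) x = act b x \<sqinter> act c x \<sqinter> x"
    unfolding act_inf act_eq_proj_inv[of b] act_eq_proj_inv[of c] by (simp add: ac_simps)
  then show ?thesis
    using act_le[of c x] by (simp add: inf.absorb1 inf.coboundedI2)
qed

end

context open_B_locale
begin

lemma support_Sup: "support act (\<Squnion>S) = \<Squnion>(support act ` S)"
  using support_hom by (rule B_module_hom.hom_Sup)

lemma support_act: "support act (act b x) = b \<sqinter> support act x"
  using support_hom by (rule B_module_hom.hom_act)

lemma support_le_iff: "support act x \<le> b \<longleftrightarrow> x \<le> proj_inv act b"
  using support_left_adjoint by (simp add: left_adjoint_def)

text \<open>The unit of the adjunction gives x \<le> p^*(\<varsigma>(x)), and acting on x is meeting
  it with p^*.\<close>

lemma act_support_self: "act (support act x) x = x"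
  using support_le_iff[of x "support act x"] by (simp add: act_eq_proj_inv inf.absorb2)

lemma support_mono: "x \<le> y \<Longrightarrow> support act x \<le> support act y"
  using support_le_iff[of x "support act y"] support_le_iff[of y "support act y"] by simp

lemma local_section_locale_iso:
  assumes "s \<in> local_sections act"
  shows "locale_iso_down (support act s) s (\<lambda>b. act b s)"
proof -
  have sec: "act (support act x) s = x" if "x \<le> s" for x
    using assms that by (simp add: local_sections_def)
  have retract: "support act (act b s) = b" if "b \<le> support act s" for b
    using that by (simp add: support_act inf.absorb1)
  \<comment> \<open>The support of an open locale need not preserve binary meets. Below a local
    section it does: x and y are restrictions of \<open>s\<close>, so their meet is the restriction
    of \<open>s\<close> along the meet of their supports, which \<open>retract\<close>
    recovers.\<close>
  have "support act (x \<sqinter> y) = support act x \<sqinter> support act y" if "x \<le> s" "y \<le> s" for x y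
  proof -
    have "x \<sqinter> y = act (support act x \<sqinter> support act y) s"
      using that by (simp add: act_inf_left sec)
    also have "support act \<dots> = support act x \<sqinter> support act y"
      using that by (intro retract le_infI1 support_mono)
    finally show ?thesis .
  qed
  then have "frame_hom_down s (support act s) (support act)"
    by (auto simp: frame_hom_down_def support_Sup support_mono)
  moreover have "frame_hom_down (support act s) s (\<lambda>b. act b s)"
    by (auto simp: frame_hom_down_def act_le act_Sup_left act_inf_left act_support_self)
  ultimately show ?thesis
    unfolding locale_iso_down_def using sec retract by blast
qed

text \<open>Surjectivity of \<open>\<theta>\<close> turns each x \<le> s into a restriction b s with
  b \<le> \<varsigma>(s), and then \<varsigma>(x) = b.\<close>

lemma local_section_if_locale_iso:
  assumes iso: "locale_iso_down (support act s) s \<theta>"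
    and \<theta>: "\<And>b. \<theta> (b \<sqinter> support act s) = proj_inv act b \<sqinter> s"
  shows "s \<in> local_sections act"
proof -
  have "act (support act x) s = x" if "x \<le> s" for x
  proof -
    obtain g where g: "g ` {..s} \<subseteq> {..support act s}" "\<forall>y\<in>{..s}. \<theta> (g y) = y"
      using iso unfolding locale_iso_down_def frame_hom_down_def by metis
    define b where "b = g x"
    have b: "b \<le> support act s" "\<theta> b = x"
      using g that by (auto simp: b_def)
    \<comment> \<open>As \<open>b\<close> lies below the support of \<open>s\<close>, meeting it
      with that support leaves it unchanged, so \<open>\<theta>\<close> evaluates \<open>b\<close>
      itself.\<close>
    then have x: "x = act b s"
      using \<theta>[of b] by (simp add: act_eq_proj_inv inf.absorb1)
    with b show ?thesis
      by (simp add: support_act inf.absorb1)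
  qed
  then show ?thesis
    by (simp add: local_sections_def)
qed

lemma local_section_iff:
  "s \<in> local_sections act \<longleftrightarrow>
    (\<exists>\<theta>. locale_iso_down (support act s) s \<theta> \<and>
      (\<forall>b. \<theta> (b \<sqinter> support act s) = proj_inv act b \<sqinter> s))"
proof
  assume "s \<in> local_sections act"
  \<comment> \<open>Here \<open>b\<close> is arbitrary: cutting it down to the support of
    \<open>s\<close> does not change its action on \<open>s\<close>.\<close>
  moreover have "act (b \<sqinter> support act s) s = proj_inv act b \<sqinter> s" for b
    by (simp add: act_inf act_support_self act_eq_proj_inv[symmetric])
  ultimately show "\<exists>\<theta>. locale_iso_down (support act s) s \<theta> \<and>
      (\<forall>b. \<theta> (b \<sqinter> support act s) = proj_inv act b \<sqinter> s)"
    using local_section_locale_iso by blast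
qed (metis local_section_if_locale_iso)

end

theorem theorem2p15:
  fixes act :: "'b::frame \<Rightarrow> 'x::frame \<Rightarrow> 'x"
  assumes "open_B_locale act"
  shows "etale act \<longleftrightarrow> proj_local_homeomorphism act"
proof -
  have "proj_local_homeomorphism act \<longleftrightarrow> (\<exists>G \<subseteq> local_sections act. \<Squnion>G = \<top>)"
    unfolding proj_local_homeomorphism_def open_B_locale.local_section_iff[OF assms, symmetric]
    using assms by blast
  \<comment> \<open>The set of all local sections is the largest candidate for \<open>G\<close>, so
    it covers as soon as some \<open>G\<close> does.\<close>
  also have "\<dots> \<longleftrightarrow> \<Squnion>(local_sections act) = \<top>"
  proof
    assume "\<exists>G \<subseteq> local_sections act. \<Squnion>G = \<top>"
    then obtain G where "G \<subseteq> local_sections act" "\<Squnion>G = \<top>"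
      by auto
    then show "\<Squnion>(local_sections act) = \<top>"
      using Sup_subset_mono[of G "local_sections act"] by (simp add: top_unique)
  qed auto
  finally show ?thesis
    using assms by (simp add: etale_def)
qed

end
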